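(* Let $X$ be a non-Euclidean finite-dimensional real normed space and let $G=(V,E)$ be a finite simple graph with $|V|\geq 2$. If $G$ is globally rigid in $X$, then $G$ is 2-connected.
   Context: A normed space is non-Euclidean if its norm does not satisfy the parallelogram law. For a graph $G=(V,E)$, a placement is $p=(p_v)_{v\in V}\in X^V$ and $(G,p)$ is a framework. Frameworks $(G,p),(G,q)$ are equivalent if $\|p_v-p_w\|=\|q_v-q_w\|$ for all $vw\in E$, and congruent if $q_v=g(p_v)$ for all $v$ for some isometry $g$ of $X$. $(G,p)$ is globally rigid if every framework equivalent to it is congruent to it; $G$ is globally rigid in $X$ if the set of $p\in X^V$ with $(G,p)$ globally rigid has non-empty interior in $X^V$. *)

theory Defs
  imports "HOL-Analysis.Analysis" "Graph_Theory.Graph_Theory"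
begin

text \<open>
  A finite simple graph is a \<^locale>\<open>graph\<close> of the Graph\_Theory library: a finite, loop-free
  digraph without parallel arcs whose arc relation is symmetric. An undirected edge is
  a pair of opposite arcs, and the edge relation is \<^const>\<open>arcs_ends\<close>.

  The normed space is a whole type of class \<^class>\<open>real_normed_vector\<close>. The class
  \<^class>\<open>euclidean_space\<close> is not suitable, as it forces the norm to come from an inner product.
\<close>

definition parallelogram_law :: "('a::real_vector \<Rightarrow> real) \<Rightarrow> bool" where
  "parallelogram_law nrm \<longleftrightarrow>
     (\<forall>x y. (nrm (x + y))\<^sup>2 + (nrm (x - y))\<^sup>2 = 2 * (nrm x)\<^sup>2 + 2 * (nrm y)\<^sup>2)"

definition placements :: "('v, 'e) pre_digraph \<Rightarrow> ('v \<Rightarrow> 'a::real_normed_vector) set" where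
  "placements G = verts G \<rightarrow>\<^sub>E UNIV"

definition equivalent_frameworks ::
    "('v, 'e) pre_digraph \<Rightarrow> ('v \<Rightarrow> 'a::real_normed_vector) \<Rightarrow> ('v \<Rightarrow> 'a) \<Rightarrow> bool" where
  "equivalent_frameworks G p q \<longleftrightarrow>
     (\<forall>(v, w) \<in> arcs_ends G. norm (p v - p w) = norm (q v - q w))"

text \<open>Surjectivity is not required; in finite dimension it is automatic.\<close>

definition isometry :: "('a::real_normed_vector \<Rightarrow> 'a) \<Rightarrow> bool" where
  "isometry g \<longleftrightarrow> (\<forall>x y. dist (g x) (g y) = dist x y)"

definition congruent_frameworks ::
    "('v, 'e) pre_digraph \<Rightarrow> ('v \<Rightarrow> 'a::real_normed_vector) \<Rightarrow> ('v \<Rightarrow> 'a) \<Rightarrow> bool" where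
  "congruent_frameworks G p q \<longleftrightarrow> (\<exists>g. isometry g \<and> (\<forall>v \<in> verts G. q v = g (p v)))"

definition globally_rigid_framework ::
    "('v, 'e) pre_digraph \<Rightarrow> ('v \<Rightarrow> 'a::real_normed_vector) \<Rightarrow> bool" where
  "globally_rigid_framework G p \<longleftrightarrow>
     (\<forall>q \<in> placements G. equivalent_frameworks G p q \<longrightarrow> congruent_frameworks G p q)"

definition globally_rigid ::
    "'a::real_normed_vector itself \<Rightarrow> ('v, 'e) pre_digraph \<Rightarrow> bool" where
  "globally_rigid X G \<longleftrightarrow>
     product_topology (\<lambda>_. euclidean) (verts G) interior_of
       {p :: 'v \<Rightarrow> 'a. p \<in> placements G \<and> globally_rigid_framework G p} \<noteq> {}"

text \<open>
  The standard convention, requiring more than \<open>k\<close> vertices; in particular the complete graph on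
  two vertices is not 2-connected. The case \<open>S = {}\<close> includes connectedness of \<open>G\<close> itself.
\<close>

definition k_connected :: "nat \<Rightarrow> ('v, 'e) pre_digraph \<Rightarrow> bool" where
  "k_connected k G \<longleftrightarrow> card (verts G) > k \<and>
     (\<forall>S \<subseteq> verts G. card S < k \<longrightarrow> Digraph_Component.connected (G \<restriction> (verts G - S)))"

end

theory Submission
  imports Defs
begin

text \<open>
  Suppose that removing a set \<open>S\<close> of at most one vertex disconnects \<open>G\<close>, with \<open>a\<close> and \<open>b\<close> on
  different sides, and let \<open>z\<close> be the position of the vertex in \<open>S\<close> (any point if \<open>S = {}\<close>).
  Reflecting one side in \<open>z\<close> preserves all edge lengths, so global rigidity gives
  \<open>norm (2 z - p a - p b) = norm (p a - p b)\<close>. This persists when \<open>z\<close> alone is moved slightly,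
  although the norm is not locally constant.

  If \<open>G\<close> has two vertices, the isometries fixing 0 act transitively on spheres; they are surjective
  by compactness and therefore linear by the Mazur-Ulam theorem. Among the quadratic forms \<open>q\<close> with
  \<open>norm\<^sup>2 \<le> q \<le> c norm\<^sup>2\<close> choose one with \<open>c\<close> minimal. If \<open>q x < c (norm x)\<^sup>2\<close> for some \<open>x\<close>, then
  by transitivity and compactness the average of finitely many translates of \<open>q\<close> stays strictly
  below \<open>c norm\<^sup>2\<close> on a sphere, contradicting minimality. Hence \<open>q = c norm\<^sup>2\<close> and the norm is
  Euclidean.
\<close>

section \<open>Finite-dimensional normed spaces\<close>

lemma compact_PiE_UNIV:
  fixes S :: "'i \<Rightarrow> 'b::topological_space set"
  assumes "\<And>i. compact (S i)"
  shows "compact (Pi\<^sub>E UNIV S)"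
  using assms compactin_PiE[of "\<lambda>_. euclidean" UNIV S] by (simp add: euclidean_product_topology)

lemma independent_norm_combination_ge:
  fixes B :: "'a::real_normed_vector set"
  assumes fin: "finite B" and ind: "independent B"
  obtains e where "e > 0" "\<And>c. (\<Sum>b\<in>B. \<bar>c b\<bar>) = 1 \<Longrightarrow> e \<le> norm (\<Sum>b\<in>B. c b *\<^sub>R b)"
proof -
  define f where "f c = (\<Sum>b\<in>B. c b *\<^sub>R b)" for c :: "'a \<Rightarrow> real"
  define K where "K = (UNIV \<rightarrow>\<^sub>E {-1..1}) \<inter> {c :: 'a \<Rightarrow> real. (\<Sum>b\<in>B. \<bar>c b\<bar>) = 1}"
  have "compact K"
    unfolding K_def
    by (intro compact_Int_closed compact_PiE_UNIV closed_Collect_eq continuous_intros) simp_all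
  moreover have "continuous_on K f"
    unfolding f_def
    by (intro continuous_intros continuous_on_subset[OF continuous_on_product_coordinates subset_UNIV])
  ultimately have "closed (f ` K)"
    by (intro compact_imp_closed compact_continuous_image)
  moreover have "0 \<notin> f ` K"
  proof
    assume "0 \<in> f ` K"
    then obtain c where c: "(\<Sum>b\<in>B. c b *\<^sub>R b) = 0" "(\<Sum>b\<in>B. \<bar>c b\<bar>) = 1"
      by (auto simp: f_def K_def)
    have "\<forall>b\<in>B. c b = 0"
      using ind c(1) dependent_finite[OF fin] by blast
    then show False using c(2) by simp
  qed
  ultimately obtain e where e: "e > 0" "\<forall>z\<in>f ` K. \<not> dist z 0 < e"
    by (metis closed_approachable)
  have "e \<le> norm (f c)" if c: "(\<Sum>b\<in>B. \<bar>c b\<bar>) = 1" for c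
  proof -
    define c' where "c' b = (if b \<in> B then c b else 0)" for b
    have "\<bar>c b\<bar> \<le> 1" if "b \<in> B" for b
      unfolding c[symmetric] using that fin by (intro member_le_sum) auto
    then have "c' \<in> K" using c by (auto simp: K_def c'_def abs_le_iff minus_le_iff)
    moreover have "f c' = f c" by (simp add: f_def c'_def)
    ultimately show ?thesis using e(2) by force
  qed
  then show ?thesis using that[of e] e(1) by (simp add: f_def)
qed

lemma independent_sum_abs_coeffs_le_norm:
  fixes B :: "'a::real_normed_vector set"
  assumes fin: "finite B" and ind: "independent B"
  obtains C where "C > 0" "\<And>c. (\<Sum>b\<in>B. \<bar>c b\<bar>) \<le> C * norm (\<Sum>b\<in>B. c b *\<^sub>R b)"
proof -
  obtain e where e: "e > 0" "\<And>c. (\<Sum>b\<in>B. \<bar>c b\<bar>) = 1 \<Longrightarrow> e \<le> norm (\<Sum>b\<in>B. c b *\<^sub>R b)"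
    using independent_norm_combination_ge[OF fin ind] by blast
  have "(\<Sum>b\<in>B. \<bar>c b\<bar>) \<le> 1 / e * norm (\<Sum>b\<in>B. c b *\<^sub>R b)" for c :: "'a \<Rightarrow> real"
  proof (cases "(\<Sum>b\<in>B. \<bar>c b\<bar>) = 0")
    case False
    define M where "M = (\<Sum>b\<in>B. \<bar>c b\<bar>)"
    have M: "M > 0" using False by (simp add: M_def order_less_le sum_nonneg)
    then have "(\<Sum>b\<in>B. \<bar>c b / M\<bar>) = 1"
      by (simp add: M_def flip: sum_divide_distrib)
    then have "e \<le> norm (\<Sum>b\<in>B. (c b / M) *\<^sub>R b)" by (rule e(2))
    also have "(\<Sum>b\<in>B. (c b / M) *\<^sub>R b) = (1 / M) *\<^sub>R (\<Sum>b\<in>B. c b *\<^sub>R b)"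
      by (simp add: scaleR_sum_right)
    finally show ?thesis using e(1) M by (simp add: field_simps flip: M_def)
  qed (use e(1) in simp)
  then show ?thesis using that[of "1 / e"] e(1) by simp
qed

lemma bounded_linear_representation:
  fixes B :: "'a::real_normed_vector set"
  assumes fin: "finite B" and ind: "independent B" and span: "span B = UNIV"
  shows "bounded_linear (\<lambda>x. representation B x b)"
proof -
  obtain C where C: "C > 0" "\<And>c. (\<Sum>b\<in>B. \<bar>c b\<bar>) \<le> C * norm (\<Sum>b\<in>B. c b *\<^sub>R b)"
    using independent_sum_abs_coeffs_le_norm[OF fin ind] by blast
  have "\<bar>representation B x b\<bar> \<le> norm x * C" for x
  proof (cases "b \<in> B")
    case True
    then have "\<bar>representation B x b\<bar> \<le> (\<Sum>b\<in>B. \<bar>representation B x b\<bar>)"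
      using fin by (intro member_le_sum) auto
    also have "\<dots> \<le> norm x * C"
      using C(2)[of "representation B x"] sum_representation_eq[OF ind _ fin, of x] span
      by (simp add: mult.commute)
    finally show ?thesis .
  next
    case False
    then have "representation B x b = 0" using representation_ne_zero by blast
    then show ?thesis using C(1) by simp
  qed
  then show ?thesis
    using ind span
    by (intro bounded_linear_intro[of _ C]) (simp_all add: representation_add representation_scale)
qed

lemma finite_span_bounded_coordinates:
  fixes B :: "'a::real_normed_vector set"
  assumes fin: "finite B" and span: "span B = UNIV"
  obtains c where "\<And>b. bounded_linear (\<lambda>x. c x b)" "\<And>x. (\<Sum>b\<in>B. c x b *\<^sub>R b) = x"
proof -
  obtain B' where B': "B' \<subseteq> B" "independent B'" "B \<subseteq> span B'"
    using maximal_independent_subset[of B] by blast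
  have fin': "finite B'" using B'(1) fin by (rule finite_subset)
  have span': "span B' = UNIV"
    using span_mono[OF B'(3)] by (auto simp: span span_span)
  show ?thesis
  proof
    show "bounded_linear (\<lambda>x. representation B' x b)" for b
      by (rule bounded_linear_representation[OF fin' B'(2) span'])
    fix x
    have "(\<Sum>b\<in>B. representation B' x b *\<^sub>R b) = (\<Sum>b\<in>B'. representation B' x b *\<^sub>R b)"
      using fin B'(1) by (intro sum.mono_neutral_right) (auto intro: representation_ne_zero)
    also have "\<dots> = x"
      using span' by (intro sum_representation_eq B'(2) fin') auto
    finally show "(\<Sum>b\<in>B. representation B' x b *\<^sub>R b) = x" .
  qed
qed

lemma finite_span_bounded_closed_imp_compact:
  fixes B S :: "'a::real_normed_vector set"
  assumes fin: "finite B" and span: "span B = UNIV" and S: "bounded S" "closed S"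
  shows "compact S"
proof -
  obtain r where r: "\<And>x. x \<in> S \<Longrightarrow> norm x \<le> r" using S(1) by (auto simp: bounded_iff)
  obtain c where lin: "\<And>b. bounded_linear (\<lambda>x. c x b)" and c: "\<And>x::'a. (\<Sum>b\<in>B. c x b *\<^sub>R b) = x"
    using finite_span_bounded_coordinates[OF fin span] by blast
  have "\<exists>K\<ge>0. \<forall>x. \<bar>c x b\<bar> \<le> norm x * K" for b
    using bounded_linear.nonneg_bounded[OF lin] by simp
  then obtain K where K: "\<And>b. K b \<ge> 0" "\<And>x b. \<bar>c x b\<bar> \<le> norm x * K b" by metis
  define f where "f a = (\<Sum>b\<in>B. a b *\<^sub>R b)" for a :: "'a \<Rightarrow> real"
  define P where "P = (\<Pi>\<^sub>E b\<in>UNIV. {- (r * K b)..r * K b})"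
  have "continuous_on P f"
    unfolding f_def
    by (intro continuous_intros continuous_on_subset[OF continuous_on_product_coordinates subset_UNIV])
  then have "compact (f ` P)"
    by (rule compact_continuous_image) (auto simp: P_def intro: compact_PiE_UNIV)
  moreover have "S \<subseteq> f ` P"
  proof
    fix x assume x: "x \<in> S"
    have "\<bar>c x b\<bar> \<le> r * K b" for b
      using K(2)[of x b] mult_right_mono[OF r[OF x] K(1)[of b]] by simp
    then have "c x \<in> P" by (auto simp: P_def abs_le_iff minus_le_iff)
    then show "x \<in> f ` P" using c[of x] by (force simp: f_def)
  qed
  then have "S = f ` P \<inter> S" by blast
  ultimately show "compact S" using S(2) compact_Int_closed[of "f ` P" S] by simp
qed

section \<open>The Mazur-Ulam theorem\<close>

lemma additive_continuous_imp_linear: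
  fixes f :: "'a::real_normed_vector \<Rightarrow> 'b::real_normed_vector"
  assumes add: "\<And>x y. f (x + y) = f x + f y" and cont: "continuous_on UNIV f"
  shows "linear f"
proof (rule linearI[OF add])
  interpret Modules.additive f by unfold_locales (rule add)
  fix r x
  define R where "R = {r. f (r *\<^sub>R x) = r *\<^sub>R f x}"
  have nat: "f (of_nat n *\<^sub>R y) = of_nat n *\<^sub>R f y" for n y
    by (induction n) (simp_all add: zero add scaleR_add_left)
  have int: "f (of_int k *\<^sub>R y) = of_int k *\<^sub>R f y" for k y
    by (cases k) (simp_all add: nat minus del: of_nat_Suc)
  have "\<rat> \<subseteq> R"
  proof
    fix r :: real assume "r \<in> \<rat>"
    then obtain k :: int and n :: nat where n: "n \<noteq> 0" and r: "r = of_int k / of_nat n"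
      by (auto simp: Rats_eq_int_div_nat)
    have "of_nat n *\<^sub>R f (r *\<^sub>R x) = f (of_int k *\<^sub>R x)"
      using n by (simp add: r flip: nat)
    also have "\<dots> = of_nat n *\<^sub>R (r *\<^sub>R f x)"
      using n by (simp add: r int)
    finally show "r \<in> R" using n by (simp add: R_def del: scaleR_scaleR)
  qed
  moreover have "closed R"
    unfolding R_def
    by (intro closed_Collect_eq continuous_on_compose2[OF cont] continuous_intros) simp
  ultimately have "closure \<rat> \<subseteq> R" by (rule closure_minimal)
  then show "f (r *\<^sub>R x) = r *\<^sub>R f x" by (auto simp: Rats_closure_real R_def)
qed

lemma isometry_imp_inj:
  fixes f :: "'a::metric_space \<Rightarrow> 'b::metric_space"
  assumes "\<And>x y. dist (f x) (f y) = dist x y"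
  shows "inj f"
  by (metis assms dist_eq_0_iff injI)

lemma isometry_inv:
  fixes f :: "'a::metric_space \<Rightarrow> 'b::metric_space"
  assumes "\<And>x y. dist (f x) (f y) = dist x y" and "surj f"
  shows "dist (inv f x) (inv f y) = dist x y"
  by (metis assms surj_f_inv_f)

lemma isometry_reflection_conjugate:
  fixes f :: "'a::real_normed_vector \<Rightarrow> 'b::real_normed_vector"
  assumes f: "\<And>x y. dist (f x) (f y) = dist x y" "surj f"
  shows "dist (u - inv f (w - f x)) (u - inv f (w - f y)) = dist x y"
    and "surj (\<lambda>x. u - inv f (w - f x))"
proof -
  have minus: "dist (v - p) (v - q) = dist p q" for v p q :: "'c::real_normed_vector"
    by (simp add: dist_norm norm_minus_commute)
  show "dist (u - inv f (w - f x)) (u - inv f (w - f y)) = dist x y"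
    using isometry_inv[OF f] by (simp add: minus f(1))
  show "surj (\<lambda>x. u - inv f (w - f x))"
    using f(2) isometry_imp_inj[OF f(1)]
    by (intro surjI[of _ "\<lambda>y. inv f (w - f (u - y))"]) (simp add: surj_f_inv_f)
qed

lemma isometry_doubling_midpoint_displacement:
  fixes h :: "'a::real_normed_vector \<Rightarrow> 'a"
  assumes h: "isometry h" "surj h" "h a = a" "h b = b"
  obtains k where "isometry k" "surj k" "k a = a" "k b = b"
    "dist (k (midpoint a b)) (midpoint a b) = 2 * dist (h (midpoint a b)) (midpoint a b)"
proof
  define z where "z = midpoint a b"
  \<comment> \<open>The trick of Vaisala: conjugate \<open>inv h\<close> by the reflection in \<open>z\<close> and compose with \<open>h\<close>.\<close>
  define k where "k x = a + b - inv h (a + b - h x)" for x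
  have iso: "dist (h x) (h y) = dist x y" for x y using h(1) by (simp add: isometry_def)
  show "isometry k" "surj k"
    unfolding k_def isometry_def using isometry_reflection_conjugate[OF iso h(2)] by auto
  show "k a = a" "k b = b"
    using inv_f_f[OF isometry_imp_inj[OF iso], of a] inv_f_f[OF isometry_imp_inj[OF iso], of b]
    by (simp_all add: k_def h(3,4))
  have ab: "a + b = z + z" by (simp add: z_def)
  have "dist (k z) z = dist z (inv h (a + b - h z))"
    by (simp add: k_def dist_norm ab)
  also have "\<dots> = norm (h z - (a + b - h z))"
    using iso[of z "inv h (a + b - h z)"] h(2) by (simp add: surj_f_inv_f dist_norm)
  also have "h z - (a + b - h z) = 2 *\<^sub>R (h z - z)"
    by (simp add: ab scaleR_2)
  finally show "dist (k (midpoint a b)) (midpoint a b) = 2 * dist (h (midpoint a b)) (midpoint a b)"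
    by (simp add: z_def dist_norm)
qed

lemma isometry_fixes_midpoint:
  fixes h :: "'a::real_normed_vector \<Rightarrow> 'a"
  assumes "isometry h" "surj h" "h a = a" "h b = b"
  shows "h (midpoint a b) = midpoint a b"
proof -
  define z where "z = midpoint a b"
  define W where "W = {h. isometry h \<and> surj h \<and> h a = a \<and> h b = b}"
  define s where "s = (SUP h\<in>W. dist (h z) z)"
  have h: "h \<in> W" using assms by (simp add: W_def)
  have "dist (h z) z \<le> 2 * dist a z" if "h \<in> W" for h
  proof -
    have "dist (h z) (h a) = dist z a" and "h a = a"
      using that unfolding W_def isometry_def by blast+
    then show ?thesis using dist_triangle[of "h z" z a] by (simp add: dist_commute)
  qed
  then have "bdd_above ((\<lambda>h. dist (h z) z) ` W)" by (rule bdd_aboveI2)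
  then have upper: "dist (h z) z \<le> s" if "h \<in> W" for h
    unfolding s_def using that by (intro cSUP_upper)
  have "dist (h z) z \<le> s / 2" if "h \<in> W" for h
  proof -
    have h: "isometry h" "surj h" "h a = a" "h b = b" using that by (simp_all add: W_def)
    obtain k where k: "isometry k" "surj k" "k a = a" "k b = b" "dist (k z) z = 2 * dist (h z) z"
      unfolding z_def by (rule isometry_doubling_midpoint_displacement[OF h])
    then have "k \<in> W" by (simp add: W_def)
    then show ?thesis using upper[of k] k(5) by simp
  qed
  then have "s \<le> s / 2"
    unfolding s_def using h by (intro cSUP_least) auto
  then have "dist (h z) z = 0" using upper[OF h] zero_le_dist[of "h z" z] by linarith
  then show ?thesis by (simp add: z_def)
qed

lemma isometry_midpoint:
  fixes f :: "'a::real_normed_vector \<Rightarrow> 'b::real_normed_vector"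
  assumes f: "\<And>x y. dist (f x) (f y) = dist x y" "surj f"
  shows "f (midpoint a b) = midpoint (f a) (f b)"
proof -
  define k where "k x = a + b - inv f (f a + f b - f x)" for x
  have "isometry k" "surj k"
    unfolding k_def isometry_def using isometry_reflection_conjugate[OF f] by auto
  moreover have "k a = a" "k b = b"
    using isometry_imp_inj[OF f(1)] by (simp_all add: k_def)
  ultimately have "k (midpoint a b) = midpoint a b" by (rule isometry_fixes_midpoint)
  then have "inv f (f a + f b - f (midpoint a b)) = midpoint a b"
    unfolding k_def by (metis add_diff_cancel_left' diff_diff_eq2 midpoint_plus_self)
  then have "f a + f b - f (midpoint a b) = f (midpoint a b)"
    using f(2) by (metis surj_f_inv_f)
  then show ?thesis by (metis midpoint_eq_iff diff_add_cancel)
qed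

theorem Mazur_Ulam:
  fixes f :: "'a::real_normed_vector \<Rightarrow> 'b::real_normed_vector"
  assumes f: "\<And>x y. dist (f x) (f y) = dist x y" "surj f" "f 0 = 0"
  shows "linear f"
proof (rule additive_continuous_imp_linear)
  have half: "f ((1 / 2) *\<^sub>R x) = (1 / 2) *\<^sub>R f x" for x
    using isometry_midpoint[OF f(1,2), of x 0] f(3) by (simp add: midpoint_def)
  have "(1 / 2) *\<^sub>R f (x + y) = (1 / 2) *\<^sub>R (f x + f y)" for x y
    using isometry_midpoint[OF f(1,2), of x y] half[of "x + y"] by (simp add: midpoint_def)
  then show "f (x + y) = f x + f y" for x y by simp
  show "continuous_on UNIV f"
    by (intro continuous_onI) (use f(1) in \<open>auto intro!: exI less_imp_le\<close>)
qed

lemma compact_isometric_image_eq: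
  fixes f :: "'a::metric_space \<Rightarrow> 'a"
  assumes K: "compact K" and f: "f ` K \<subseteq> K"
    and iso: "\<And>x y. x \<in> K \<Longrightarrow> y \<in> K \<Longrightarrow> dist (f x) (f y) = dist x y"
  shows "f ` K = K"
proof (rule ccontr)
  assume "f ` K \<noteq> K"
  then obtain y where y: "y \<in> K" "y \<notin> f ` K" using f by blast
  have "continuous_on K f"
    by (intro continuous_onI) (use iso in \<open>auto intro!: exI less_imp_le\<close>)
  then have "closed (f ` K)"
    using K by (intro compact_imp_closed compact_continuous_image)
  then obtain e where "e > 0" "\<forall>z\<in>f ` K. \<not> dist z y < e"
    using y(2) by (metis closed_approachable)
  then have e: "e > 0" "\<And>z. z \<in> K \<Longrightarrow> e \<le> dist y (f z)" by (auto simp: dist_commute)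
  define s where "s n = (f ^^ n) y" for n
  have s: "s n \<in> K" for n
    by (induction n) (use y(1) f in \<open>auto simp: s_def\<close>)
  have sep: "e \<le> dist (s m) (s (m + Suc k))" for m k
  proof (induction m)
    case 0
    then show ?case using e(2)[OF s[of k]] by (simp add: s_def)
  next
    case (Suc m)
    then show ?case using iso[OF s s, of m "m + Suc k"] by (simp add: s_def)
  qed
  obtain l \<phi> where \<phi>: "strict_mono \<phi>" "(s \<circ> \<phi>) \<longlonglongrightarrow> l"
    using K s unfolding compact_def by meson
  then have "Cauchy (s \<circ> \<phi>)" by (intro LIMSEQ_imp_Cauchy)
  then obtain M where M: "dist (s (\<phi> M)) (s (\<phi> (Suc M))) < e"
    using e(1) unfolding Cauchy_def comp_def by (meson le_refl lessI less_imp_le)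
  have "\<phi> M < \<phi> (Suc M)" using \<phi>(1) by (simp add: strict_mono_Suc_iff)
  then obtain k where "\<phi> (Suc M) = \<phi> M + Suc k" using less_iff_Suc_add by auto
  then show False using sep[of "\<phi> M" k] M by simp
qed

lemma norm_isometry:
  assumes "isometry g" "g 0 = 0"
  shows "norm (g x) = norm x"
  using assms unfolding isometry_def by (metis dist_0_norm)

lemma finite_span_isometry_surj:
  fixes g :: "'a::real_normed_vector \<Rightarrow> 'a"
  assumes fin: "finite B" and span: "span B = (UNIV :: 'a set)" and g: "isometry g"
  shows "surj g"
  unfolding surj_def
proof
  fix y
  define h where "h x = g x - g 0" for x
  define K where "K = cball (0::'a) (norm (y - g 0))"
  have h: "isometry h" "h 0 = 0" using g by (simp_all add: h_def isometry_def dist_norm)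
  have "h ` K = K"
  proof (rule compact_isometric_image_eq)
    show "compact K"
      unfolding K_def by (intro finite_span_bounded_closed_imp_compact[OF fin span]) simp_all
  qed (use h norm_isometry[OF h] in \<open>auto simp: K_def isometry_def\<close>)
  moreover have "y - g 0 \<in> K" by (simp add: K_def)
  ultimately obtain x where "y - g 0 = h x" by blast
  then have "y = g x" by (simp add: h_def)
  then show "\<exists>x. y = g x" ..
qed

corollary finite_span_isometry_linear:
  fixes g :: "'a::real_normed_vector \<Rightarrow> 'a"
  assumes "finite B" "span B = (UNIV :: 'a set)" "isometry g" "g 0 = 0"
  shows "linear g"
  using assms finite_span_isometry_surj[OF assms(1-3)] by (intro Mazur_Ulam) (auto simp: isometry_def)

corollary finite_span_linear_isometry_factor:
  fixes g h :: "'a::real_normed_vector \<Rightarrow> 'a"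
  assumes fin: "finite B" and span: "span B = (UNIV :: 'a set)"
    and g: "isometry g" and h: "isometry h" and zero: "g v = 0" "h v = 0"
  obtains f where "linear f" "isometry f" "\<And>x. f (g x) = h x"
proof
  have iso: "dist (g x) (g y) = dist x y" for x y using g by (simp add: isometry_def)
  have surj: "surj g" by (rule finite_span_isometry_surj[OF fin span g])
  have comm: "(h \<circ> inv g) (g x) = h x" for x using isometry_imp_inj[OF iso] by simp
  then show "(h \<circ> inv g) (g x) = h x" for x .
  show "isometry (h \<circ> inv g)"
    using h isometry_inv[OF iso surj] by (simp add: isometry_def)
  then show "linear (h \<circ> inv g)"
    using comm[of v] zero by (intro finite_span_isometry_linear[OF fin span]) simp_all
qed

section \<open>Spaces with transitive linear isometries\<close>

text \<open>
  A quadratic form with polar form \<open>\<beta>\<close> satisfies \<open>q x - q y = \<beta> (x - y) (x + y)\<close>, so the third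
  condition bounds \<open>\<beta>\<close>.
\<close>

definition bounded_quadratic_form :: "real \<Rightarrow> ('a::real_normed_vector \<Rightarrow> real) \<Rightarrow> bool" where
  "bounded_quadratic_form D q \<longleftrightarrow>
     (\<forall>x y. q (x + y) + q (x - y) = 2 * q x + 2 * q y) \<and>
     (\<forall>r x. q (r *\<^sub>R x) = r\<^sup>2 * q x) \<and>
     (\<forall>x y. \<bar>q x - q y\<bar> \<le> D * norm (x - y) * norm (x + y))"

lemma
  assumes "bounded_quadratic_form D q"
  shows bounded_quadratic_form_parallelogram: "q (x + y) + q (x - y) = 2 * q x + 2 * q y"
    and bounded_quadratic_form_scaleR: "q (r *\<^sub>R x) = r\<^sup>2 * q x"
    and bounded_quadratic_form_diff_le: "\<bar>q x - q y\<bar> \<le> D * norm (x - y) * norm (x + y)"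
  using assms by (simp_all add: bounded_quadratic_form_def)

lemma bounded_quadratic_form_zero: "bounded_quadratic_form D q \<Longrightarrow> q 0 = 0"
  using bounded_quadratic_form_scaleR[of D q 0 0] by simp

lemma bounded_quadratic_form_le:
  assumes "bounded_quadratic_form D q"
  shows "q x \<le> D * (norm x)\<^sup>2"
  using bounded_quadratic_form_diff_le[OF assms, of x 0] bounded_quadratic_form_zero[OF assms]
  by (simp add: power2_eq_square mult.assoc)

lemma continuous_on_bounded_quadratic_form:
  assumes "bounded_quadratic_form D q"
  shows "continuous_on S q"
  unfolding continuous_on_def
proof
  fix x
  have "((\<lambda>y. D * norm (y - x) * norm (y + x)) \<longlongrightarrow> D * norm (x - x) * norm (x + x)) (at x within S)"
    by (intro tendsto_intros)
  then have "((\<lambda>y. q y - q x) \<longlongrightarrow> 0) (at x within S)"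
    using bounded_quadratic_form_diff_le[OF assms]
    by (intro Lim_null_comparison[of "\<lambda>y. q y - q x" "\<lambda>y. D * norm (y - x) * norm (y + x)"]) auto
  then show "(q \<longlongrightarrow> q x) (at x within S)" by (simp only: LIM_zero_iff)
qed

lemma bounded_quadratic_form_comp:
  assumes q: "bounded_quadratic_form D q" and g: "linear g" "isometry g"
  shows "bounded_quadratic_form D (\<lambda>x. q (g x))"
proof -
  have "norm (g x) = norm x" for x
    using norm_isometry[OF g(2) linear_0[OF g(1)]] .
  then have "\<bar>q (g x) - q (g y)\<bar> \<le> D * norm (x - y) * norm (x + y)" for x y
    using bounded_quadratic_form_diff_le[OF q, of "g x" "g y"]
    by (simp flip: linear_diff[OF g(1)] linear_add[OF g(1)])
  then show ?thesis
    unfolding bounded_quadratic_form_def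
    by (simp add: linear_add[OF g(1)] linear_diff[OF g(1)] linear_scale[OF g(1)]
        bounded_quadratic_form_parallelogram[OF q] bounded_quadratic_form_scaleR[OF q])
qed

lemma bounded_quadratic_form_square:
  fixes f :: "'a::real_normed_vector \<Rightarrow> real"
  assumes f: "linear f" and K: "\<And>x. \<bar>f x\<bar> \<le> norm x * K"
  shows "bounded_quadratic_form (K\<^sup>2) (\<lambda>x. (f x)\<^sup>2)"
proof -
  have "\<bar>(f x)\<^sup>2 - (f y)\<^sup>2\<bar> \<le> K\<^sup>2 * norm (x - y) * norm (x + y)" for x y
  proof -
    have "\<bar>(f x)\<^sup>2 - (f y)\<^sup>2\<bar> = \<bar>f (x - y)\<bar> * \<bar>f (x + y)\<bar>"
      by (simp add: linear_add[OF f] linear_diff[OF f] power2_eq_square algebra_simps flip: abs_mult)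
    also have "\<dots> \<le> (norm (x - y) * K) * (norm (x + y) * K)"
      using order_trans[OF abs_ge_zero K] by (intro mult_mono K) auto
    finally show ?thesis by (simp add: power2_eq_square mult_ac)
  qed
  then show ?thesis
    unfolding bounded_quadratic_form_def
    by (simp add: linear_add[OF f] linear_diff[OF f] linear_scale[OF f] power_mult_distrib)
      (simp add: power2_eq_square algebra_simps)
qed

lemma bounded_quadratic_form_sum:
  assumes q: "\<And>i. i \<in> I \<Longrightarrow> bounded_quadratic_form (D i) (q i)"
  shows "bounded_quadratic_form (\<Sum>i\<in>I. D i) (\<lambda>x. \<Sum>i\<in>I. q i x)"
  unfolding bounded_quadratic_form_def
proof (intro conjI allI)
  fix x y
  have "(\<Sum>i\<in>I. q i (x + y)) + (\<Sum>i\<in>I. q i (x - y)) = (\<Sum>i\<in>I. 2 * q i x + 2 * q i y)"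
    unfolding sum.distrib[symmetric]
    by (intro sum.cong refl bounded_quadratic_form_parallelogram[OF q])
  then show "(\<Sum>i\<in>I. q i (x + y)) + (\<Sum>i\<in>I. q i (x - y)) = 2 * (\<Sum>i\<in>I. q i x) + 2 * (\<Sum>i\<in>I. q i y)"
    by (simp add: sum.distrib sum_distrib_left)
  have "\<bar>(\<Sum>i\<in>I. q i x) - (\<Sum>i\<in>I. q i y)\<bar> \<le> (\<Sum>i\<in>I. \<bar>q i x - q i y\<bar>)"
    unfolding sum_subtractf[symmetric] by (rule sum_abs)
  also have "\<dots> \<le> (\<Sum>i\<in>I. D i * norm (x - y) * norm (x + y))"
    by (intro sum_mono bounded_quadratic_form_diff_le[OF q])
  finally show "\<bar>(\<Sum>i\<in>I. q i x) - (\<Sum>i\<in>I. q i y)\<bar> \<le> (\<Sum>i\<in>I. D i) * norm (x - y) * norm (x + y)"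
    by (simp add: sum_distrib_right)
next
  fix r x
  show "(\<Sum>i\<in>I. q i (r *\<^sub>R x)) = r\<^sup>2 * (\<Sum>i\<in>I. q i x)"
    by (simp add: bounded_quadratic_form_scaleR[OF q] sum_distrib_left)
qed

lemma bounded_quadratic_form_cmult:
  assumes q: "bounded_quadratic_form D q" and a: "a \<ge> 0"
  shows "bounded_quadratic_form (a * D) (\<lambda>x. a * q x)"
  unfolding bounded_quadratic_form_def
proof (intro conjI allI)
  show "a * q (x + y) + a * q (x - y) = 2 * (a * q x) + 2 * (a * q y)" for x y
    using arg_cong[OF bounded_quadratic_form_parallelogram[OF q, of x y], of "(*) a"]
    by (simp add: algebra_simps)
  show "\<bar>a * q x - a * q y\<bar> \<le> a * D * norm (x - y) * norm (x + y)" for x y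
    using mult_left_mono[OF bounded_quadratic_form_diff_le[OF q] a, of x y] a
    by (simp add: abs_mult mult.assoc flip: right_diff_distrib)
qed (simp add: bounded_quadratic_form_scaleR[OF q])

lemma bounded_quadratic_form_le_of_sphere:
  assumes q: "bounded_quadratic_form D q" and r: "r > 0"
    and le: "\<And>y. norm y = r \<Longrightarrow> q y \<le> M"
  shows "q x \<le> M / r\<^sup>2 * (norm x)\<^sup>2"
proof (cases "x = 0")
  case True
  then show ?thesis by (simp add: bounded_quadratic_form_zero[OF q])
next
  case False
  have "q x = (norm x / r)\<^sup>2 * q ((r / norm x) *\<^sub>R x)"
    using False r by (simp add: bounded_quadratic_form_scaleR[OF q] power_divide)
  also have "\<dots> \<le> (norm x / r)\<^sup>2 * M"
    using False r by (intro mult_left_mono le) auto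
  finally show ?thesis by (simp add: power_divide mult.commute)
qed

lemma finite_span_ex_quadratic_form_ge_norm:
  fixes B :: "'a::real_normed_vector set"
  assumes fin: "finite B" and span: "span B = UNIV"
  obtains D q where "bounded_quadratic_form D q" "\<And>x::'a. (norm x)\<^sup>2 \<le> q x"
proof -
  obtain c where lin: "\<And>b. bounded_linear (\<lambda>x. c x b)" and c: "\<And>x::'a. (\<Sum>b\<in>B. c x b *\<^sub>R b) = x"
    using finite_span_bounded_coordinates[OF fin span] by blast
  have "\<exists>K. \<forall>x. \<bar>c x b\<bar> \<le> norm x * K" for b
    using bounded_linear.bounded[OF lin] by simp
  then obtain K where K: "\<And>x b. \<bar>c x b\<bar> \<le> norm x * K b" by metis
  define E where "E = (\<Sum>b\<in>B. (norm b)\<^sup>2)"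
  show ?thesis
  proof
    show "bounded_quadratic_form (E * (\<Sum>b\<in>B. (K b)\<^sup>2)) (\<lambda>x. E * (\<Sum>b\<in>B. (c x b)\<^sup>2))"
      by (intro bounded_quadratic_form_cmult bounded_quadratic_form_sum bounded_quadratic_form_square
          bounded_linear.linear[OF lin] K) (simp add: E_def sum_nonneg)
  next
    fix x
    have "norm x \<le> (\<Sum>b\<in>B. norm (c x b *\<^sub>R b))"
      using norm_sum[of "\<lambda>b. c x b *\<^sub>R b" B] by (simp only: c)
    then have "(norm x)\<^sup>2 \<le> (\<Sum>b\<in>B. \<bar>c x b\<bar> * norm b)\<^sup>2"
      by (intro power_mono) simp_all
    also have "\<dots> \<le> (\<Sum>b\<in>B. \<bar>c x b\<bar>\<^sup>2) * E"
      unfolding E_def by (rule Cauchy_Schwarz_ineq_sum)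
    finally show "(norm x)\<^sup>2 \<le> E * (\<Sum>b\<in>B. (c x b)\<^sup>2)" by (simp add: mult.commute)
  qed
qed

text \<open>
  Carrying \<open>c\<close> along turns the extremal constant into a continuous coordinate, so that it attains
  its minimum by Tychonoff's theorem.
\<close>

definition norm_pinched_forms :: "real \<Rightarrow> (('a::real_normed_vector \<Rightarrow> real) \<times> real) set" where
  "norm_pinched_forms D = {(q, c). bounded_quadratic_form D q \<and> 0 \<le> c \<and>
     (\<forall>x. (norm x)\<^sup>2 \<le> q x \<and> q x \<le> c * (norm x)\<^sup>2)}"

lemma norm_pinched_formsD:
  assumes "(q, c) \<in> norm_pinched_forms D"
  shows "bounded_quadratic_form D q" and "0 \<le> c" and "(norm x)\<^sup>2 \<le> q x" and "q x \<le> c * (norm x)\<^sup>2"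
  using assms by (simp_all add: norm_pinched_forms_def)

lemma closed_norm_pinched_forms:
  "closed (norm_pinched_forms D :: (('a::real_normed_vector \<Rightarrow> real) \<times> real) set)"
proof -
  have "continuous_on UNIV (\<lambda>p :: ('a \<Rightarrow> real) \<times> real. fst p x)" for x
    by (rule continuous_on_product_then_coordinatewise[OF continuous_on_fst[OF continuous_on_id]])
  then show ?thesis
    unfolding norm_pinched_forms_def bounded_quadratic_form_def case_prod_beta
    by (intro closed_Collect_conj closed_Collect_all closed_Collect_eq closed_Collect_le
        continuous_intros)
qed

lemma finite_span_ex_norm_pinched_form:
  fixes B :: "'a::real_normed_vector set"
  assumes fin: "finite B" and span: "span B = UNIV"
  obtains D c and q :: "'a::real_normed_vector \<Rightarrow> real" where "(q, c) \<in> norm_pinched_forms D"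
proof -
  obtain D and q :: "'a \<Rightarrow> real" where q: "bounded_quadratic_form D q" "\<And>x. (norm x)\<^sup>2 \<le> q x"
    using finite_span_ex_quadratic_form_ge_norm[OF fin span] by blast
  have "q x \<le> max 0 D * (norm x)\<^sup>2" for x
    using bounded_quadratic_form_le[OF q(1), of x] mult_right_mono[of D "max 0 D" "(norm x)\<^sup>2"]
    by simp
  then have "(q, max 0 D) \<in> norm_pinched_forms D"
    using q by (simp add: norm_pinched_forms_def)
  then show ?thesis by (rule that)
qed

lemma norm_pinched_forms_attains_min:
  fixes q0 :: "'a::real_normed_vector \<Rightarrow> real"
  assumes q0: "(q0, c0) \<in> norm_pinched_forms D"
  obtains q :: "'a \<Rightarrow> real" and c where "is_arg_min snd (\<lambda>p. p \<in> norm_pinched_forms D) (q, c)"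
proof -
  define P :: "(('a \<Rightarrow> real) \<times> real) set" where "P = (\<Pi>\<^sub>E x\<in>UNIV. {0..c0 * (norm x)\<^sup>2}) \<times> {0..c0}"
  have "compact P"
    unfolding P_def by (intro compact_Times compact_PiE_UNIV) simp_all
  then have cpt: "compact (P \<inter> norm_pinched_forms D)"
    using closed_norm_pinched_forms by (rule compact_Int_closed)
  have P: "(q, c) \<in> P" if "(q, c) \<in> norm_pinched_forms D" "c \<le> c0" for q c
  proof -
    note q = norm_pinched_formsD(2-4)[OF that(1)]
    have "0 \<le> q x" for x using q(2)[of x] by (rule order_trans[OF zero_le_power2])
    moreover have "q x \<le> c0 * (norm x)\<^sup>2" for x
      using q(3)[of x] mult_right_mono[OF that(2) zero_le_power2[of "norm x"]] by linarith
    ultimately show ?thesis using q(1) that(2) by (simp add: P_def PiE_UNIV_domain)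
  qed
  have "P \<inter> norm_pinched_forms D \<noteq> {}" using q0 P[OF q0] by blast
  then obtain q c where qc: "(q, c) \<in> P \<inter> norm_pinched_forms D"
    and min: "\<And>p. p \<in> P \<inter> norm_pinched_forms D \<Longrightarrow> c \<le> snd p"
    using continuous_attains_inf[OF cpt _ continuous_on_snd[OF continuous_on_id]]
    by (metis prod.collapse)
  have "c \<le> c'" if "(q', c') \<in> norm_pinched_forms D" for q' :: "'a \<Rightarrow> real" and c'
    using min[of "(q', c')"] P[OF that] that qc by (cases "c' \<le> c0") (auto simp: P_def)
  then show ?thesis
    using qc that by (force simp: is_arg_min_linorder)
qed

lemma norm_pinched_forms_average:
  assumes fin: "finite F" and ne: "F \<noteq> {}" and iso: "\<And>g. g \<in> F \<Longrightarrow> linear g \<and> isometry g"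
    and q: "(q, c) \<in> norm_pinched_forms D"
  shows "(\<lambda>x. (\<Sum>g\<in>F. q (g x)) / card F, c) \<in> norm_pinched_forms D"
proof -
  note form = norm_pinched_formsD(1)[OF q]
    and q_ge = norm_pinched_formsD(3)[OF q] and q_le = norm_pinched_formsD(4)[OF q]
  have card: "real (card F) > 0" using fin ne by (simp add: card_gt_0_iff)
  have "bounded_quadratic_form (1 / card F * (\<Sum>g\<in>F. D)) (\<lambda>x. 1 / card F * (\<Sum>g\<in>F. q (g x)))"
    using iso by (intro bounded_quadratic_form_cmult bounded_quadratic_form_sum
        bounded_quadratic_form_comp[OF form]) auto
  then have form': "bounded_quadratic_form D (\<lambda>x. (\<Sum>g\<in>F. q (g x)) / card F)"
    using card by simp
  have norm: "norm (g x) = norm x" if "g \<in> F" for g x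
    using iso[OF that] norm_isometry linear_0 by blast
  have "(norm x)\<^sup>2 \<le> (\<Sum>g\<in>F. q (g x)) / card F" for x
    using sum_bounded_below[of F "(norm x)\<^sup>2" "\<lambda>g. q (g x)"] q_ge norm card
    by (metis le_divide_eq mult.commute)
  moreover have "(\<Sum>g\<in>F. q (g x)) / card F \<le> c * (norm x)\<^sup>2" for x
    using sum_bounded_above[of F "\<lambda>g. q (g x)" "c * (norm x)\<^sup>2"] q_le norm card
    by (metis divide_le_eq mult.commute)
  ultimately show ?thesis
    using form' norm_pinched_formsD(2)[OF q] by (simp add: norm_pinched_forms_def)
qed

lemma norm_pinched_forms_decrease:
  fixes q :: "'a::real_normed_vector \<Rightarrow> real"
  assumes q: "(q, c) \<in> norm_pinched_forms D"
    and x0: "x0 \<noteq> (0::'a)" and cpt: "compact (sphere (0::'a) (norm x0))"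
    and less: "\<And>x. norm x = norm x0 \<Longrightarrow> q x < c * (norm x0)\<^sup>2"
  obtains c' where "(q, c') \<in> norm_pinched_forms D" "c' < c"
proof -
  note form = norm_pinched_formsD(1)[OF q] and q_ge = norm_pinched_formsD(3)[OF q]
  have "x0 \<in> sphere 0 (norm x0)" by simp
  then obtain y where y: "norm y = norm x0" "\<And>x. norm x = norm x0 \<Longrightarrow> q x \<le> q y"
    using continuous_attains_sup[OF cpt _ continuous_on_bounded_quadratic_form[OF form]]
    by (metis empty_iff mem_sphere_0)
  show ?thesis
  proof
    have "0 \<le> q y" using q_ge[of y] by (rule order_trans[OF zero_le_power2])
    moreover have "q x \<le> q y / (norm x0)\<^sup>2 * (norm x)\<^sup>2" for x
      using y(2) x0 by (intro bounded_quadratic_form_le_of_sphere[OF form]) auto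
    ultimately show "(q, q y / (norm x0)\<^sup>2) \<in> norm_pinched_forms D"
      using form q_ge by (simp add: norm_pinched_forms_def)
    show "q y / (norm x0)\<^sup>2 < c"
      using less[OF y(1)] x0 by (simp add: divide_less_eq)
  qed
qed

lemma average_less:
  fixes f :: "'i \<Rightarrow> real"
  assumes fin: "finite F" and le: "\<And>i. i \<in> F \<Longrightarrow> f i \<le> M" and i: "i \<in> F" "f i < M"
  shows "(\<Sum>i\<in>F. f i) / card F < M"
proof -
  have "(\<Sum>i\<in>F. f i) < (\<Sum>i\<in>F. M)"
    using le i by (intro sum_strict_mono_ex1 fin) auto
  moreover have "card F > 0" using fin i(1) by (auto simp: card_gt_0_iff)
  ultimately show ?thesis by (simp add: divide_less_eq mult.commute)
qed

lemma norm_pinched_forms_improve: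
  fixes x0 :: "'a::real_normed_vector"
  assumes cpt: "compact (sphere (0::'a) (norm x0))"
    and trans: "\<And>y::'a. norm y = norm x0 \<Longrightarrow> \<exists>g. linear g \<and> isometry g \<and> g y = x0"
    and q: "(q, c) \<in> norm_pinched_forms D" and less: "q x0 < c * (norm x0)\<^sup>2"
  obtains q' :: "'a \<Rightarrow> real" and c' where "(q', c') \<in> norm_pinched_forms D" "c' < c"
proof -
  define L where "L = {g :: 'a \<Rightarrow> 'a. linear g \<and> isometry g}"
  define U where "U g = {x. q (g x) < c * (norm x0)\<^sup>2}" for g :: "'a \<Rightarrow> 'a"
  note form = norm_pinched_formsD(1)[OF q]
  have "open (U g)" if "g \<in> L" for g
    unfolding U_def using that
    by (intro open_Collect_less continuous_on_const
        continuous_on_bounded_quadratic_form[OF bounded_quadratic_form_comp[OF form]]) (auto simp: L_def)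
  moreover have "sphere 0 (norm x0) \<subseteq> (\<Union>g\<in>L. U g)"
    using trans less unfolding L_def U_def by fastforce
  ultimately obtain F where F: "F \<subseteq> L" "finite F" "sphere 0 (norm x0) \<subseteq> (\<Union>g\<in>F. U g)"
    by (rule compactE_image[OF cpt])
  have "F \<noteq> {}" using F(3) by (auto dest: subsetD[of _ _ x0])
  define q' where "q' x = (\<Sum>g\<in>F. q (g x)) / card F" for x
  have "(q', c) \<in> norm_pinched_forms D"
    unfolding q'_def using F(1,2) \<open>F \<noteq> {}\<close> q by (intro norm_pinched_forms_average) (auto simp: L_def)
  moreover have "x0 \<noteq> 0" using less bounded_quadratic_form_zero[OF form] by auto
  moreover have "q' x < c * (norm x0)\<^sup>2" if x: "norm x = norm x0" for x
  proof -
    obtain g where "g \<in> F" "q (g x) < c * (norm x0)\<^sup>2" using F(3) x by (auto simp: U_def)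
    moreover have "q (g x) \<le> c * (norm x0)\<^sup>2" if "g \<in> F" for g
      using norm_pinched_formsD(4)[OF q, of "g x"] that F(1) x norm_isometry[of g x] linear_0[of g]
      by (auto simp: L_def)
    ultimately show ?thesis unfolding q'_def using F(2) by (intro average_less)
  qed
  ultimately obtain c' where "(q', c') \<in> norm_pinched_forms D" "c' < c"
    using norm_pinched_forms_decrease[OF _ _ cpt] by blast
  then show ?thesis by (rule that)
qed

lemma norm_pinched_forms_min_eq:
  fixes q :: "'a::real_normed_vector \<Rightarrow> real"
  assumes cpt: "compact (sphere (0::'a) (norm x))"
    and trans: "\<And>y::'a. norm y = norm x \<Longrightarrow> \<exists>g. linear g \<and> isometry g \<and> g y = x"
    and min: "is_arg_min snd (\<lambda>p. p \<in> norm_pinched_forms D) (q, c)"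
  shows "q x = c * (norm x)\<^sup>2"
proof -
  have q: "(q, c) \<in> norm_pinched_forms D" using min unfolding is_arg_min_def by (rule conjunct1)
  have "\<not> q x < c * (norm x)\<^sup>2"
  proof
    assume "q x < c * (norm x)\<^sup>2"
    then obtain q' :: "'a \<Rightarrow> real" and c' where "(q', c') \<in> norm_pinched_forms D" "c' < c"
      using norm_pinched_forms_improve[OF cpt trans q] by blast
    then show False using min by (force simp: is_arg_min_def)
  qed
  then show ?thesis using norm_pinched_formsD(4)[OF q, of x] by simp
qed

theorem transitive_linear_isometries_imp_parallelogram_law:
  fixes B :: "'a::real_normed_vector set"
  assumes fin: "finite B" and span: "span B = UNIV"
    and trans: "\<And>x y :: 'a. norm x = norm y \<Longrightarrow> \<exists>g. linear g \<and> isometry g \<and> g x = y"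
  shows "parallelogram_law (norm :: 'a \<Rightarrow> real)"
proof -
  obtain D c0 and q0 :: "'a \<Rightarrow> real" where "(q0, c0) \<in> norm_pinched_forms D"
    by (rule finite_span_ex_norm_pinched_form[OF fin span])
  then obtain q :: "'a \<Rightarrow> real" and c where min: "is_arg_min snd (\<lambda>p. p \<in> norm_pinched_forms D) (q, c)"
    by (rule norm_pinched_forms_attains_min)
  then have q: "(q, c) \<in> norm_pinched_forms D" unfolding is_arg_min_def by (rule conjunct1)
  have "compact (sphere (0::'a) r)" for r
    unfolding cball_diff_eq_sphere[symmetric]
    by (intro compact_diff finite_span_bounded_closed_imp_compact[OF fin span]) simp_all
  then have q_eq: "q x = c * (norm x)\<^sup>2" for x
    using trans min by (rule norm_pinched_forms_min_eq)
  show ?thesis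
  proof (cases "c = 0")
    case True
    then have "norm x = 0" for x :: 'a using norm_pinched_formsD(3)[OF q, of x] q_eq[of x] by simp
    then show ?thesis unfolding parallelogram_law_def by (simp only:) simp
  next
    case False
    have "c * ((norm (x + y))\<^sup>2 + (norm (x - y))\<^sup>2) = c * (2 * (norm x)\<^sup>2 + 2 * (norm y)\<^sup>2)"
      for x y :: 'a
      using bounded_quadratic_form_parallelogram[OF norm_pinched_formsD(1)[OF q], of x y]
      by (simp add: q_eq algebra_simps)
    then show ?thesis using False unfolding parallelogram_law_def by simp
  qed
qed

section \<open>Global rigidity\<close>

lemma (in wf_digraph) equivalent_frameworks_cong:
  assumes "\<And>v. v \<in> verts G \<Longrightarrow> p v = p' v" and "\<And>v. v \<in> verts G \<Longrightarrow> q v = q' v"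
  shows "equivalent_frameworks G p q \<longleftrightarrow> equivalent_frameworks G p' q'"
  unfolding equivalent_frameworks_def using assms adj_in_verts by (intro ball_cong refl) fastforce

lemma (in wf_digraph) globally_rigid_framework_cong:
  assumes "\<And>v. v \<in> verts G \<Longrightarrow> p v = p' v"
  shows "globally_rigid_framework G p \<longleftrightarrow> globally_rigid_framework G p'"
  unfolding globally_rigid_framework_def congruent_frameworks_def
  using assms equivalent_frameworks_cong[of p p'] by simp

lemma (in wf_digraph) globally_rigid_framework_imp_congruent:
  assumes rigid: "globally_rigid_framework G p" and equiv: "equivalent_frameworks G p q"
  shows "congruent_frameworks G p q"
proof -
  have "restrict q (verts G) \<in> placements G" by (simp add: placements_def)
  moreover have "equivalent_frameworks G p (restrict q (verts G))"
    using equiv equivalent_frameworks_cong[of p p q "restrict q (verts G)"] by simp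
  ultimately have "congruent_frameworks G p (restrict q (verts G))"
    using rigid unfolding globally_rigid_framework_def by blast
  then show ?thesis by (simp add: congruent_frameworks_def)
qed

lemma congruent_frameworks_dist:
  assumes "congruent_frameworks G p q" "v \<in> verts G" "w \<in> verts G"
  shows "norm (q v - q w) = norm (p v - p w)"
  using assms by (auto simp: congruent_frameworks_def isometry_def simp flip: dist_norm)

lemma (in fin_digraph) globally_rigidE:
  assumes "globally_rigid TYPE('x::real_normed_vector) G"
  obtains p :: "'a \<Rightarrow> 'x::real_normed_vector" and e where "e > 0"
    "\<And>q. (\<And>v. v \<in> verts G \<Longrightarrow> dist (p v) (q v) < e) \<Longrightarrow> globally_rigid_framework G q"
proof -
  obtain T and p :: "'a \<Rightarrow> 'x" where T: "openin (product_topology (\<lambda>_. euclidean) (verts G)) T"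
    "p \<in> T" "\<And>q. q \<in> T \<Longrightarrow> globally_rigid_framework G q"
    using assms unfolding globally_rigid_def interior_of_def by blast
  obtain U where U: "\<And>v. v \<in> verts G \<Longrightarrow> open (U v)" "p \<in> Pi\<^sub>E (verts G) U" "Pi\<^sub>E (verts G) U \<subseteq> T"
    using T(1,2) unfolding openin_product_topology_alt by (metis open_openin)
  have "\<exists>e>0. ball (p v) e \<subseteq> U v" if "v \<in> verts G" for v
    using U(1)[OF that] U(2) that by (meson PiE_mem open_contains_ball)
  then obtain r where r: "\<And>v. v \<in> verts G \<Longrightarrow> r v > 0 \<and> ball (p v) (r v) \<subseteq> U v"
    by metis
  define e where "e = Min (insert 1 (r ` verts G))"
  have e: "e > 0" "\<And>v. v \<in> verts G \<Longrightarrow> e \<le> r v"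
    using r by (auto simp: e_def)
  show ?thesis
  proof
    show "e > 0" by (rule e)
    fix q assume q: "\<And>v. v \<in> verts G \<Longrightarrow> dist (p v) (q v) < e"
    have "q v \<in> U v" if "v \<in> verts G" for v
      using q[OF that] e(2)[OF that] r[OF that] by (auto simp: subset_iff)
    then have "restrict q (verts G) \<in> T" using U(3) by auto
    then have "globally_rigid_framework G (restrict q (verts G))" by (rule T(3))
    then show "globally_rigid_framework G q"
      using globally_rigid_framework_cong[of q "restrict q (verts G)"] by simp
  qed
qed

lemma not_connected_induce_subgraphE:
  assumes "\<not> Digraph_Component.connected (G \<restriction> W)" and "W \<noteq> {}"
  obtains A B where "A \<union> B = W" "A \<inter> B = {}" "A \<noteq> {}" "B \<noteq> {}"
    "arcs_ends G \<inter> (A \<times> B \<union> B \<times> A) = {}"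
proof -
  let ?R = "rtrancl_on W ((arcs_ends (G \<restriction> W))\<^sup>s)"
  obtain a b where ab: "a \<in> W" "b \<in> W" "(a, b) \<notin> ?R"
    using assms by (auto simp: connected_conv)
  define A where "A = {x \<in> W. (a, x) \<in> ?R}"
  have closed: "y \<in> A" if "x \<in> A" "y \<in> W" "(x, y) \<in> (arcs_ends (G \<restriction> W))\<^sup>s" for x y
    using that by (auto simp: A_def intro: rtrancl_on_into_rtrancl_on)
  have "arcs_ends G \<inter> (A \<times> (W - A) \<union> (W - A) \<times> A) = {}"
  proof -
    have "(x, y) \<in> (arcs_ends (G \<restriction> W))\<^sup>s" "(y, x) \<in> (arcs_ends (G \<restriction> W))\<^sup>s"
      if "(x, y) \<in> arcs_ends G" "x \<in> W" "y \<in> W" for x y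
      using that by (auto simp: arcs_ends_conv symcl_def)
    moreover have "A \<subseteq> W" by (auto simp: A_def)
    ultimately show ?thesis using closed by blast
  qed
  moreover have "a \<in> A" "b \<in> W - A" using ab by (auto simp: A_def)
  ultimately show ?thesis using ab that[of A "W - A"] by (auto simp: A_def)
qed

lemma norm_not_locally_constant:
  fixes z w :: "'a::real_normed_vector"
  assumes w: "w \<noteq> 0" and e: "e > 0"
  obtains h where "norm h < e" "norm (z + h) \<noteq> norm z"
proof (cases "z = 0")
  case True
  show ?thesis
  proof
    show "norm ((e / 2 / norm w) *\<^sub>R w) < e" using w e by simp
    show "norm (z + (e / 2 / norm w) *\<^sub>R w) \<noteq> norm z" using True w e by simp
  qed
next
  case False
  define k where "k = e / 2 / norm z"
  have k: "k > 0" using False e by (simp add: k_def)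
  show ?thesis
  proof
    show "norm (k *\<^sub>R z) < e" using False e by (simp add: k_def)
    have "norm (z + k *\<^sub>R z) = (1 + k) * norm z"
      using k norm_scaleR[of "1 + k" z] by (simp add: scaleR_add_left)
    then show "norm (z + k *\<^sub>R z) \<noteq> norm z" using False k by simp
  qed
qed

lemma (in wf_digraph) globally_rigid_framework_reflect:
  fixes p :: "'a \<Rightarrow> 'x::real_normed_vector"
  assumes rigid: "globally_rigid_framework G p"
    and cover: "verts G \<subseteq> A \<union> B \<union> S" and disj: "A \<inter> B = {}"
    and sep: "arcs_ends G \<inter> (A \<times> B \<union> B \<times> A) = {}"
    and S: "\<And>s. s \<in> S \<Longrightarrow> p s = c"
    and ab: "a \<in> A" "a \<in> verts G" "b \<in> B" "b \<in> verts G"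
  shows "norm (2 *\<^sub>R c - p a - p b) = norm (p a - p b)"
proof -
  define f where "f u = (if u \<in> A then 2 *\<^sub>R c - p u else p u)" for u
  have "equivalent_frameworks G p f"
    unfolding equivalent_frameworks_def
  proof clarify
    fix x y assume xy: "(x, y) \<in> arcs_ends G"
    have "y \<in> S" if "x \<in> A" "y \<notin> A" using xy that cover sep adj_in_verts(2)[OF xy] by blast
    moreover have "x \<in> S" if "y \<in> A" "x \<notin> A" using xy that cover sep adj_in_verts(1)[OF xy] by blast
    ultimately show "norm (p x - p y) = norm (f x - f y)"
      using S by (auto simp: f_def scaleR_2 norm_minus_commute algebra_simps)
  qed
  then have "norm (f a - f b) = norm (p a - p b)"
    by (intro congruent_frameworks_dist[OF globally_rigid_framework_imp_congruent[OF rigid]] ab)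
  moreover have "b \<notin> A" using ab(3) disj by blast
  ultimately show ?thesis using ab(1) by (simp add: f_def)
qed

lemma (in fin_digraph) globally_rigid_imp_connected_minus:
  fixes w :: "'x::real_normed_vector"
  assumes w: "w \<noteq> 0" and rigid: "globally_rigid TYPE('x) G"
    and S: "S \<subseteq> {v}" and ne: "verts G - S \<noteq> {}"
  shows "Digraph_Component.connected (G \<restriction> (verts G - S))"
proof (rule ccontr)
  assume "\<not> Digraph_Component.connected (G \<restriction> (verts G - S))"
  then obtain A B where AB: "A \<union> B = verts G - S" "A \<inter> B = {}" "A \<noteq> {}" "B \<noteq> {}"
    and sep: "arcs_ends G \<inter> (A \<times> B \<union> B \<times> A) = {}"
    using not_connected_induce_subgraphE[OF _ ne] by metis
  then obtain a b where ab: "a \<in> A" "b \<in> B" by blast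
  obtain p :: "'a \<Rightarrow> 'x" and e where e: "e > 0"
    and near: "\<And>q. (\<And>v. v \<in> verts G \<Longrightarrow> dist (p v) (q v) < e) \<Longrightarrow> globally_rigid_framework G q"
    using globally_rigidE[OF rigid] by metis
  define z where "z = 2 *\<^sub>R p v - p a - p b"
  have const: "norm (z + h) = norm (p a - p b)" if h: "norm h < e" for h
  proof -
    define q where "q u = (if u \<in> S then p v + (1 / 2) *\<^sub>R h else p u)" for u
    have "globally_rigid_framework G q"
      by (rule near) (use h e S in \<open>auto simp: q_def dist_norm\<close>)
    then have "norm (2 *\<^sub>R (p v + (1 / 2) *\<^sub>R h) - q a - q b) = norm (q a - q b)"
      using AB ab sep
      by (intro globally_rigid_framework_reflect[of q A B S]) (auto simp: q_def)
    moreover have "q a = p a" "q b = p b" using AB(1) ab by (auto simp: q_def)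
    ultimately show ?thesis by (simp add: z_def algebra_simps)
  qed
  obtain h where "norm h < e" "norm (z + h) \<noteq> norm z"
    using norm_not_locally_constant[OF w e] by blast
  then show False using const[of h] const[of 0] e by simp
qed

lemma (in fin_digraph) globally_rigid_imp_distinct_framework:
  fixes w :: "'x::real_normed_vector"
  assumes w: "w \<noteq> 0" and rigid: "globally_rigid TYPE('x) G" and ab: "a \<noteq> b"
  obtains p :: "'a \<Rightarrow> 'x::real_normed_vector" where "globally_rigid_framework G p" "p a \<noteq> p b"
proof -
  obtain p :: "'a \<Rightarrow> 'x" and e where e: "e > 0"
    and near: "\<And>q. (\<And>v. v \<in> verts G \<Longrightarrow> dist (p v) (q v) < e) \<Longrightarrow> globally_rigid_framework G q"
    using globally_rigidE[OF rigid] by metis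
  obtain h where h: "norm h < e" "norm (p a - p b + h) \<noteq> norm (p a - p b)"
    using norm_not_locally_constant[OF w e] by blast
  have "globally_rigid_framework G p" by (rule near) (simp add: e)
  moreover have "globally_rigid_framework G (p(a := p a + h))"
    by (rule near) (use e h(1) in \<open>auto simp: dist_norm\<close>)
  moreover have "p a \<noteq> p b \<or> (p(a := p a + h)) a \<noteq> (p(a := p a + h)) b"
    using h(2) ab by auto
  ultimately show ?thesis using that by blast
qed

lemma (in wf_digraph) globally_rigid_framework_two_vertices_isometry:
  fixes p :: "'a \<Rightarrow> 'x::real_normed_vector"
  assumes rigid: "globally_rigid_framework G p" and V: "verts G = {a, b}" and ab: "a \<noteq> b"
    and z: "norm z = norm (p a - p b)"
  obtains g where "isometry g" "g (p a) = z" "g (p b) = 0"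
proof -
  define q where "q v = (if v = a then z else 0)" for v
  have "equivalent_frameworks G p q"
    unfolding equivalent_frameworks_def
  proof clarify
    fix x y assume "(x, y) \<in> arcs_ends G"
    then have "x \<in> {a, b}" "y \<in> {a, b}" using adj_in_verts V by auto
    then show "norm (p x - p y) = norm (q x - q y)"
      using z by (auto simp: q_def norm_minus_commute)
  qed
  from globally_rigid_framework_imp_congruent[OF rigid this] show ?thesis
    using V ab that by (auto simp: congruent_frameworks_def q_def)
qed

lemma (in fin_digraph) globally_rigid_two_vertices_imp_parallelogram_law:
  fixes B :: "'x::real_normed_vector set" and w :: 'x
  assumes fin: "finite B" and span: "span B = UNIV" and w: "w \<noteq> 0"
    and card2: "card (verts G) = 2" and rigid: "globally_rigid TYPE('x) G"
  shows "parallelogram_law (norm :: 'x \<Rightarrow> real)"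
proof (rule transitive_linear_isometries_imp_parallelogram_law[OF fin span])
  obtain a b where V: "verts G = {a, b}" and ab: "a \<noteq> b"
    using card2 by (auto simp: card_2_iff)
  obtain p :: "'a \<Rightarrow> 'x" where p: "globally_rigid_framework G p" "p a \<noteq> p b"
    using globally_rigid_imp_distinct_framework[OF w rigid ab] by blast
  fix x y :: 'x assume xy: "norm x = norm y"
  show "\<exists>g. linear g \<and> isometry g \<and> g x = y"
  proof (cases "x = 0")
    case True
    then show ?thesis using xy by (intro exI[of _ id]) (simp add: isometry_def linear_id)
  next
    case False
    define k where "k = norm (p a - p b) / norm x"
    have k: "k > 0" using False p(2) by (simp add: k_def)
    have norm_k: "norm (k *\<^sub>R x) = norm (p a - p b)" "norm (k *\<^sub>R y) = norm (p a - p b)"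
      using False k by (simp_all add: k_def flip: xy)
    obtain g1 g2 where g1: "isometry g1" "g1 (p a) = k *\<^sub>R x" "g1 (p b) = 0"
      and g2: "isometry g2" "g2 (p a) = k *\<^sub>R y" "g2 (p b) = 0"
      using globally_rigid_framework_two_vertices_isometry[OF p(1) V ab] norm_k by metis
    obtain g where g: "linear g" "isometry g" "\<And>u. g (g1 u) = g2 u"
      using finite_span_linear_isometry_factor[OF fin span g1(1) g2(1) g1(3) g2(3)] by blast
    have "g (k *\<^sub>R x) = k *\<^sub>R y" using g(3)[of "p a"] g1(2) g2(2) by simp
    then have "g x = y" using k by (simp add: linear_scale[OF g(1)])
    then show ?thesis using g(1,2) by blast
  qed
qed

lemma (in fin_digraph) k_connected_2I:
  assumes card: "card (verts G) > 2"
    and connected: "\<And>S v. S \<subseteq> {v} \<Longrightarrow> verts G - S \<noteq> {} \<Longrightarrow>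
      Digraph_Component.connected (G \<restriction> (verts G - S))"
  shows "k_connected 2 G"
  unfolding k_connected_def
proof (intro conjI allI impI card)
  fix S assume S: "S \<subseteq> verts G" "card S < 2"
  have fin: "finite S" using S(1) finite_verts by (rule finite_subset)
  then have "\<forall>u\<in>S. \<forall>v\<in>S. u = v" using S(2) card_le_Suc0_iff_eq[OF fin] by simp
  then obtain v where "S \<subseteq> {v}" by blast
  moreover have "verts G - S \<noteq> {}" using card_mono[OF fin, of "verts G"] card S(2) by auto
  ultimately show "Digraph_Component.connected (G \<restriction> (verts G - S))" by (rule connected)
qed

theorem theorem3p1:
  fixes G :: "('v, 'e) pre_digraph"
  assumes finite_dim: "\<exists>B. finite_dimensional_vector_space ((*\<^sub>R) :: real \<Rightarrow> 'a \<Rightarrow> 'a) B"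
    and non_euclidean: "\<not> parallelogram_law (norm :: 'a::real_normed_vector \<Rightarrow> real)"
    and simple_graph: "graph G"
    and card_verts: "card (verts G) \<ge> 2"
    and rigid: "globally_rigid TYPE('a) G"
  shows "k_connected 2 G"
proof -
  interpret graph G by fact
  obtain B :: "'a set" where B: "finite B" "span B = UNIV"
    using finite_dim finite_dimensional_vector_space.finite_Basis
      finite_dimensional_vector_space.span_Basis by (metis span_raw_def)
  obtain w :: 'a where w: "w \<noteq> 0"
    using non_euclidean unfolding parallelogram_law_def
    by (metis add.right_neutral diff_zero mult_zero_right norm_zero power_zero_numeral)
  have "card (verts G) \<noteq> 2"
    using globally_rigid_two_vertices_imp_parallelogram_law[OF B w _ rigid] non_euclidean by blast
  with card_verts have "card (verts G) > 2" by simp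
  then show ?thesis
    by (rule k_connected_2I) (rule globally_rigid_imp_connected_minus[OF w rigid])
qed

end
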